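(* Let $q=p^n$ with $p$ a prime and $n$ a positive integer, and let $g$ be a primitive element of $\mathbb{F}_q^{\times}$, i.e. a generator of the cyclic multiplicative group of nonzero elements of $\mathbb{F}_q$. Let $d$ be any positive divisor of $p^n-1$ and put $b=(p^n-1)/d$. Define $$\mathcal{S}^*=\{g^0,g^d,g^{2d},\dots,g^{(b-1)d}\},\qquad \mathcal{S}_0=\{0\},$$ $$\mathcal{S}_i=\{g^{i-1},g^{d+i-1},g^{2d+i-1},\dots,g^{(b-1)d+i-1}\},\quad i\in\{1,2,\dots,d\}.$$ Then $\mathbb{F}_q=\mathcal{S}_0\cup\mathcal{S}_1\cup\cdots\cup\mathcal{S}_d$, and $\mathcal{S}_0,\mathcal{S}_1,\dots,\mathcal{S}_d$ are confusable sets of $\mathbb{F}_q$ with randomizer $\gamma$ uniform over $\mathcal{S}^*$.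
   Context: Confusable sets and randomizer: sets $\mathcal{S}_0,\mathcal{S}_1,\mathcal{S}_2,\dots$ are called confusable sets of $\mathbb{F}_q$ with randomizer $\gamma$ if they form a partition of $\mathbb{F}_q$ and $\gamma$ is a random variable, uniform over a set $\mathcal{S}^*\subset\mathbb{F}_q$, such that for every $i$ and every $s\in\mathcal{S}_i$, the random variable $\gamma\times s$ (product in $\mathbb{F}_q$) is uniform over $\mathcal{S}_i$. *)

theory Defs
  imports "HOL-Algebra.Multiplicative_Group" "HOL-Algebra.Generated_Groups"
    "HOL-Probability.Probability"
begin

text \<open>
  A random variable with values in the (discrete) set \<open>A\<close> that is uniformly distributed on \<open>S\<close>.
  Degenerate \<open>S\<close> (empty, infinite, or not contained in \<open>A\<close>) are excluded automatically, because
  \<^term>\<open>uniform_measure (count_space A) S\<close> is then not a probability measure.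
\<close>

definition uniform_rv :: "'w measure \<Rightarrow> 'a set \<Rightarrow> ('w \<Rightarrow> 'a) \<Rightarrow> 'a set \<Rightarrow> bool" where
  "uniform_rv M A X S \<longleftrightarrow>
     prob_space M \<and> X \<in> M \<rightarrow>\<^sub>M count_space A \<and>
     distr M (count_space A) X = uniform_measure (count_space A) S"

text \<open>
  The family \<open>S\<close> indexed by \<open>I\<close> consists of confusable sets of \<open>F\<close> with randomizer \<open>\<gamma>\<close>, where
  \<open>\<gamma>\<close> is uniform over \<open>S'\<close>. Injectivity is part of being a partition for an indexed family:
  \<^const>\<open>partition_on\<close> only sees the set of its members, so it would not notice a repeated one.
\<close>

definition confusable_sets ::
  "('a, 'm) ring_scheme \<Rightarrow> 'i set \<Rightarrow> ('i \<Rightarrow> 'a set) \<Rightarrow> 'w measure \<Rightarrow> ('w \<Rightarrow> 'a) \<Rightarrow> 'a set \<Rightarrow> bool"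
where
  "confusable_sets F I S M \<gamma> S' \<longleftrightarrow>
     partition_on (carrier F) (S ` I) \<and> inj_on S I \<and>
     S' \<subseteq> carrier F \<and> uniform_rv M (carrier F) \<gamma> S' \<and>
     (\<forall>i\<in>I. \<forall>s\<in>S i. uniform_rv M (carrier F) (\<lambda>\<omega>. \<gamma> \<omega> \<otimes>\<^bsub>F\<^esub> s) (S i))"

definition primitive_element :: "('a, 'm) ring_scheme \<Rightarrow> 'a \<Rightarrow> bool" where
  "primitive_element F g \<longleftrightarrow>
     g \<in> carrier (mult_of F) \<and> generate (mult_of F) {g} = carrier (mult_of F)"

definition randomizer_set :: "('a, 'm) ring_scheme \<Rightarrow> 'a \<Rightarrow> nat \<Rightarrow> nat \<Rightarrow> 'a set" where
  "randomizer_set F g d b = {g [^]\<^bsub>F\<^esub> (k * d) | k. k < b}"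

definition coset_family :: "('a, 'm) ring_scheme \<Rightarrow> 'a \<Rightarrow> nat \<Rightarrow> nat \<Rightarrow> nat \<Rightarrow> 'a set" where
  "coset_family F g d b i =
     (if i = 0 then {\<zero>\<^bsub>F\<^esub>} else {g [^]\<^bsub>F\<^esub> (k * d + (i - 1)) | k. k < b})"

end

theory Submission
  imports Defs
begin

text \<open>
  Taking powers of \<open>g\<close> identifies the nonzero elements of \<open>F\<close> with the exponents below
  \<open>N = b * d\<close>, and \<open>S\<^sub>i\<close> (for \<open>i > 0\<close>) with the exponents congruent to \<open>i - 1\<close> modulo \<open>d\<close>; this
  gives the partition. Multiplication by an element of \<open>S\<^sub>i\<close> with \<open>i > 0\<close> maps the randomizer set
  injectively into \<open>S\<^sub>i\<close>, which has the same cardinality \<open>b\<close>, so it transports the uniform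
  distribution; multiplication by \<open>0\<close> is constant.
\<close>

text \<open>Injectivity on \<open>S\<close> makes \<open>f\<close>
  S\<open>meet\<close>T\<open>in as many points as\<close>S\<open>meets the preimage of\<close>T\<open>, and\<close>f
  \<open>S\<close> is as large as \<open>S\<close>. So both measures of \<open>T\<close> are the
  same quotient of cardinalities.\<close>

lemma uniform_rv_inj_image:
  assumes X: "uniform_rv M A X S" and S: "finite S" "S \<subseteq> A"
    and f: "f \<in> A \<rightarrow> B" and inj: "inj_on f S"
  shows "uniform_rv M B (\<lambda>\<omega>. f (X \<omega>)) (f ` S)"
proof -
  have M: "prob_space M" and XM: "X \<in> M \<rightarrow>\<^sub>M count_space A"
    and D: "distr M (count_space A) X = uniform_measure (count_space A) S"
    using X by (auto simp: uniform_rv_def)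
  have fM: "f \<in> count_space A \<rightarrow>\<^sub>M count_space B"
    using f by simp
  have fX: "(\<lambda>\<omega>. f (X \<omega>)) \<in> M \<rightarrow>\<^sub>M count_space B"
    using measurable_compose[OF XM fM] .
  have fS: "f ` S \<subseteq> B" using f S by auto
  have "distr M (count_space B) (\<lambda>\<omega>. f (X \<omega>))
      = distr (uniform_measure (count_space A) S) (count_space B) f"
    using distr_distr[OF fM XM] by (simp add: D comp_def)
  also have "\<dots> = uniform_measure (count_space B) (f ` S)"
  proof (rule measure_eqI)
    fix T assume "T \<in> sets (distr (uniform_measure (count_space A) S) (count_space B) f)"
    then have T: "T \<subseteq> B" by simp
    have "f ` S \<inter> T = f ` (S \<inter> (f -` T \<inter> A))" using S by auto
    then have "card (f ` S \<inter> T) = card (S \<inter> (f -` T \<inter> A))"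
      using inj by (simp add: card_image inj_on_subset)
    moreover have "card (f ` S) = card S" using inj by (rule card_image)
    moreover have "S \<inter> (f -` T \<inter> A) \<subseteq> A" "f ` S \<inter> T \<subseteq> B" using S fS by auto
    \<comment> \<open>\<open>uniform_measure\<close> has the space and the measurable sets of its
      base measure, so measurability of \<open>f\<close> carries over from
      \<open>count_space A\<close>.\<close>
    moreover have "f \<in> uniform_measure (count_space A) S \<rightarrow>\<^sub>M count_space B"
      using fM by (subst measurable_cong_sets[of _ "count_space A" _ "count_space B"]) auto
    then have "emeasure (distr (uniform_measure (count_space A) S) (count_space B) f) T
        = emeasure (uniform_measure (count_space A) S) (f -` T \<inter> A)"
      using T by (simp add: emeasure_distr)
    ultimately show "emeasure (distr (uniform_measure (count_space A) S) (count_space B) f) T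
        = emeasure (uniform_measure (count_space B) (f ` S)) T"
      using T S fS by (simp add: emeasure_count_space)
  qed simp
  finally show ?thesis
    using M fX by (simp add: uniform_rv_def)
qed

lemma uniform_rv_const:
  assumes "prob_space M" "c \<in> A"
  shows "uniform_rv M A (\<lambda>_. c) {c}"
proof -
  interpret prob_space M by fact
  have "distr M (count_space A) (\<lambda>_. c) = uniform_measure (count_space A) {c}"
  proof (rule measure_eqI)
    fix T assume "T \<in> sets (distr M (count_space A) (\<lambda>_. c))"
    then have T: "T \<subseteq> A" by simp
    then show "emeasure (distr M (count_space A) (\<lambda>_. c)) T
        = emeasure (uniform_measure (count_space A) {c}) T"
      using assms(2) by (cases "c \<in> T") (auto simp: emeasure_distr emeasure_count_space emeasure_space_1)
  qed simp
  then show ?thesis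
    using assms by (simp add: uniform_rv_def)
qed

text \<open>Agreement on \<open>space M\<close> has to suffice: outside it nothing forces the
  randomizer to take values in the field.\<close>

lemma uniform_rv_cong:
  assumes "uniform_rv M A X S" "\<And>\<omega>. \<omega> \<in> space M \<Longrightarrow> X \<omega> = Y \<omega>"
  shows "uniform_rv M A Y S"
  using assms measurable_cong[of M X Y "count_space A"]
    distr_cong[OF refl refl, of M X Y "count_space A"]
  by (auto simp: uniform_rv_def)

text \<open>Division with remainder: \<open>k\<close> is \<open>j div d\<close>, and since
  \<open>r < d\<close> the bound \<open>k < b\<close> amounts to \<open>j < b * d\<close>.\<close>

lemma residue_class_below:
  fixes b d r :: nat
  assumes "r < d"
  shows "{k * d + r | k. k < b} = {j. j < b * d \<and> j mod d = r}"
proof (intro equalityI subsetI)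
  fix j assume "j \<in> {k * d + r | k. k < b}"
  then obtain k where k: "j = k * d + r" "k < b" by auto
  have "j < (k + 1) * d" using k assms by simp
  also have "\<dots> \<le> b * d" using k by (intro mult_right_mono) auto
  finally show "j \<in> {j. j < b * d \<and> j mod d = r}" using k assms by simp
next
  fix j assume "j \<in> {j. j < b * d \<and> j mod d = r}"
  then have "j = (j div d) * d + r" "j div d < b"
    using less_mult_imp_div_less by auto
  then show "j \<in> {k * d + r | k. k < b}" by blast
qed

lemma card_residue_class_below:
  fixes b d r :: nat
  assumes "r < d"
  shows "card {j. j < b * d \<and> j mod d = r} = b"
proof -
  have "inj_on (\<lambda>k. k * d + r) {..<b}" using assms by (auto intro: inj_onI)
  then have "card ((\<lambda>k. k * d + r) ` {..<b}) = b" by (simp add: card_image)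
  also have "(\<lambda>k. k * d + r) ` {..<b} = {k * d + r | k. k < b}" by auto
  finally show ?thesis using residue_class_below[OF assms] by simp
qed

text \<open>The order of a generator is the group order \<open>N\<close>. Hence the powers with
  exponent below \<open>N\<close> are distinct and, by counting, exhaust the nonzero elements;
  exponents matter only modulo \<open>N\<close> because the \<open>N\<close>-th power is
  one.\<close>

lemma primitive_element_powers:
  assumes F: "field F" "finite (carrier F)" and g: "primitive_element F g"
    and N: "N = card (carrier F) - 1"
  shows "bij_betw (\<lambda>j::nat. g [^]\<^bsub>F\<^esub> j) {..<N} (carrier F - {\<zero>\<^bsub>F\<^esub>})"
    and "g [^]\<^bsub>F\<^esub> (j mod N) = g [^]\<^bsub>F\<^esub> (j::nat)"
proof -
  interpret field F by fact
  interpret G: group "mult_of F" by (rule field_mult_group)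
  have gc: "g \<in> carrier (mult_of F)"
    and gen: "generate (mult_of F) {g} = carrier (mult_of F)"
    using g by (auto simp: primitive_element_def)
  have cN: "card (carrier F - {\<zero>\<^bsub>F\<^esub>}) = N"
    using F N by simp
  have ord: "G.ord g = N"
    using G.generate_pow_card[OF gc] gen cN by simp
  \<comment> \<open>\<open>ord_inj\<close> speaks of \<open>{0..N - 1}\<close>; with truncated
    subtraction this is \<open>{..<N}\<close> only for positive \<open>N\<close>.\<close>
  have "N > 0"
    using gc cN F by (metis card_gt_0_iff carrier_mult_of empty_iff finite_mult_of)
  then have below: "{0..N - 1} = {..<N}" by auto
  have inj: "inj_on (\<lambda>j::nat. g [^]\<^bsub>F\<^esub> j) {..<N}"
    using G.ord_inj[OF gc] unfolding ord below by (simp add: nat_pow_mult_of)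
  have "(\<lambda>j::nat. g [^]\<^bsub>F\<^esub> j) ` {..<N} = carrier F - {\<zero>\<^bsub>F\<^esub>}"
  proof (rule card_subset_eq)
    show "(\<lambda>j::nat. g [^]\<^bsub>F\<^esub> j) ` {..<N} \<subseteq> carrier F - {\<zero>\<^bsub>F\<^esub>}"
      using G.nat_pow_closed[OF gc] by (auto simp: nat_pow_mult_of)
  qed (use F inj cN in \<open>auto simp: card_image\<close>)
  with inj show "bij_betw (\<lambda>j::nat. g [^]\<^bsub>F\<^esub> j) {..<N} (carrier F - {\<zero>\<^bsub>F\<^esub>})"
    by (simp add: bij_betw_def)
  have one: "g [^]\<^bsub>F\<^esub> N = \<one>\<^bsub>F\<^esub>"
    using G.pow_ord_eq_1[OF gc] ord by (simp add: nat_pow_mult_of)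
  have gF: "g \<in> carrier F" using gc by simp
  have "g [^]\<^bsub>F\<^esub> j = g [^]\<^bsub>F\<^esub> (N * (j div N) + j mod N)" by simp
  also have "\<dots> = (g [^]\<^bsub>F\<^esub> N) [^]\<^bsub>F\<^esub> (j div N) \<otimes>\<^bsub>F\<^esub> g [^]\<^bsub>F\<^esub> (j mod N)"
    using gF by (simp only: nat_pow_mult[symmetric] nat_pow_pow)
  also have "\<dots> = g [^]\<^bsub>F\<^esub> (j mod N)"
    using gF by (simp add: one)
  finally show "g [^]\<^bsub>F\<^esub> (j mod N) = g [^]\<^bsub>F\<^esub> j" by simp
qed

lemma coset_family_conv_residue_class:
  assumes "i \<in> {1..d}"
  shows "coset_family F g d b i = (\<lambda>j. g [^]\<^bsub>F\<^esub> j) ` {j. j < b * d \<and> j mod d = i - 1}"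
proof -
  have "coset_family F g d b i = (\<lambda>j. g [^]\<^bsub>F\<^esub> j) ` {k * d + (i - 1) | k. k < b}"
    using assms by (auto simp: coset_family_def)
  also have "{k * d + (i - 1) | k. k < b} = {j. j < b * d \<and> j mod d = i - 1}"
    using assms by (intro residue_class_below) auto
  finally show ?thesis .
qed

text \<open>The exponent shift \<open>i - 1\<close> vanishes at \<open>i = 1\<close>, so every fact
  on the cosets also covers the randomizer set.\<close>

lemma randomizer_set_eq_coset_family:
  "randomizer_set F g d b = coset_family F g d b 1"
  by (simp add: randomizer_set_def coset_family_def)

text \<open>Equal members at different indices would be disjoint from themselves, hence empty; this
  yields injectivity.\<close>

lemma partition_on_familyI:
  assumes "(\<Union>i\<in>I. S i) = A" "disjoint_family_on S I" "\<And>i. i \<in> I \<Longrightarrow> S i \<noteq> {}"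
  shows "partition_on A (S ` I)" and "inj_on S I"
proof -
  show "partition_on A (S ` I)"
    using assms by (auto simp: partition_on_def disjoint_family_on_disjoint_image)
  show "inj_on S I"
  proof (rule inj_onI, rule ccontr)
    fix i j assume "i \<in> I" "j \<in> I" "S i = S j" "i \<noteq> j"
    then show False
      using disjoint_family_onD[OF assms(2), of i j] assms(3)[of i] by simp
  qed
qed

theorem theorem2:
  fixes F :: "('a, 'm) ring_scheme" and g :: 'a
    and p n d b :: nat
    and M :: "'w measure" and \<gamma> :: "'w \<Rightarrow> 'a"
  assumes "prime p" and "n > 0"
    and "field F" and "card (carrier F) = p ^ n"
    and "primitive_element F g"
    and "d > 0" and "d dvd p ^ n - 1"
    and "b = (p ^ n - 1) div d"
    and "uniform_rv M (carrier F) \<gamma> (randomizer_set F g d b)"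
  shows "carrier F = (\<Union>i\<in>{0..d}. coset_family F g d b i)
    \<and> confusable_sets F {0..d} (coset_family F g d b) M \<gamma> (randomizer_set F g d b)"
proof -
  interpret field F by fact
  define C where "C = coset_family F g d b"
  define pow where "pow = (\<lambda>j::nat. g [^]\<^bsub>F\<^esub> j)"
  define E where "E = (\<lambda>i. {j. j < b * d \<and> j mod d = i - 1})"
  \<comment> \<open>\<open>card\<close> of an infinite set is 0, whereas \<open>p ^ n\<close> is
    positive.\<close>
  have fin: "finite (carrier F)"
    using assms(1,4) by (metis card.infinite prime_gt_0_nat zero_less_power less_irrefl)
  have bd: "b * d = card (carrier F) - 1"
    using assms(4,7,8) by simp
  note powers = primitive_element_powers[OF assms(3) fin assms(5) bd, folded pow_def]
  have pow_bij: "bij_betw pow {..<b * d} (carrier F - {\<zero>\<^bsub>F\<^esub>})"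
    using powers(1) by (simp add: pow_def)
  have pow_mod: "pow (j mod (b * d)) = pow j" for j
    using powers(2) by (simp add: pow_def)
  have pow_inj: "inj_on pow {..<b * d}"
    and pow_img: "pow ` {..<b * d} = carrier F - {\<zero>\<^bsub>F\<^esub>}"
    using pow_bij by (auto simp: bij_betw_def)
  have gF: "g \<in> carrier F"
    using assms(5) by (simp add: primitive_element_def)
  \<comment> \<open>With \<open>b = 0\<close> there would be no exponents, hence no nonzero
    elements, but one is nonzero.\<close>
  have b: "b > 0"
  proof (rule ccontr)
    assume "\<not> b > 0"
    then have "carrier F - {\<zero>\<^bsub>F\<^esub>} = {}" using pow_img by simp
    then show False using one_closed one_not_zero by blast
  qed
  have E_sub: "E i \<subseteq> {..<b * d}" for i by (auto simp: E_def)
  have C0: "C 0 = {\<zero>\<^bsub>F\<^esub>}" by (simp add: C_def coset_family_def)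
  have C: "C i = pow ` E i" if "i \<in> {1..d}" for i
    using coset_family_conv_residue_class[OF that] by (simp add: C_def pow_def E_def)
  have card_C: "card (C i) = b" if "i \<in> {1..d}" for i
  proof -
    have "card (C i) = card (E i)"
      using inj_on_subset[OF pow_inj E_sub[of i]] by (simp add: C[OF that] card_image)
    moreover have "i - 1 < d" using that by auto
    ultimately show ?thesis
      using card_residue_class_below[of "i - 1" d b] by (simp add: E_def)
  qed
  have C_sub: "C i \<subseteq> carrier F - {\<zero>\<^bsub>F\<^esub>}" if "i \<in> {1..d}" for i
    using image_mono[OF E_sub[of i], of pow] by (simp add: C[OF that] pow_img)
  have R: "randomizer_set F g d b = C 1"
    by (simp add: randomizer_set_eq_coset_family C_def)
  have one_d: "1 \<in> {1..d}" using assms(6) by simp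
  have fin_C: "finite (C i)" if "i \<in> {1..d}" for i
    using C_sub[OF that] fin by (meson finite_Diff finite_subset)

  have union: "(\<Union>i\<in>{0..d}. C i) = carrier F"
  proof -
    have "(\<Union>i\<in>{1..d}. E i) = {..<b * d}"
    proof (intro equalityI subsetI)
      \<comment> \<open>The residue of \<open>j\<close> determines its coset; the successor appears
        because index 0 is reserved for the zero element.\<close>
      fix j assume j: "j \<in> {..<b * d}"
      then have "j \<in> E (Suc (j mod d))" by (simp add: E_def)
      moreover have "Suc (j mod d) \<in> {1..d}" using assms(6) by (simp add: Suc_le_eq)
      ultimately show "j \<in> (\<Union>i\<in>{1..d}. E i)" by blast
    qed (use E_sub in blast)
    then have "(\<Union>i\<in>{1..d}. C i) = carrier F - {\<zero>\<^bsub>F\<^esub>}"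
      using C pow_img by (simp flip: image_UN)
    moreover have "{0..d} = insert 0 {1..d}" by auto
    ultimately show ?thesis using C0 by auto
  qed
  have disj: "disjoint_family_on C {0..d}"
    unfolding disjoint_family_on_def
  proof (intro ballI impI)
    \<comment> \<open>Positive indices are essential here: truncated subtraction gives
      \<open>E 0 = E 1\<close>, so index 0 is treated separately through \<open>C0\<close>.\<close>
    have pos: "C i \<inter> C j = {}" if "i \<in> {1..d}" "j \<in> {1..d}" "i \<noteq> j" for i j
    proof -
      have "E i \<inter> E j = {}" using that by (auto simp: E_def)
      then show ?thesis
        using inj_on_image_Int[OF pow_inj E_sub E_sub, of i j] that by (simp add: C)
    qed
    fix i j assume "i \<in> {0..d}" "j \<in> {0..d}" "i \<noteq> j"
    then consider "i = 0" "j \<in> {1..d}" | "j = 0" "i \<in> {1..d}"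
      | "i \<in> {1..d}" "j \<in> {1..d}" by fastforce
    then show "C i \<inter> C j = {}"
      using C_sub C0 pos \<open>i \<noteq> j\<close> by cases blast+
  qed
  \<comment> \<open>For positive \<open>i\<close> the coset has \<open>b > 0\<close>
    elements.\<close>
  have ne: "C i \<noteq> {}" if "i \<in> {0..d}" for i
    using that C0 card_C[of i] b by (cases "i = 0") fastforce+
  note part = partition_on_familyI[OF union disj ne]

  have unif: "uniform_rv M (carrier F) (\<lambda>\<omega>. \<gamma> \<omega> \<otimes>\<^bsub>F\<^esub> s) (C i)"
    if i: "i \<in> {0..d}" and s: "s \<in> C i" for i s
  proof (cases "i = 0")
    case True
    have M: "prob_space M" and \<gamma>: "\<gamma> \<in> M \<rightarrow>\<^sub>M count_space (carrier F)"
      using assms(9) by (auto simp: uniform_rv_def)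
    \<comment> \<open>Membership in the field is what makes the product with zero equal to zero, a
      constant on \<open>space M\<close>.\<close>
    have "\<gamma> \<omega> \<in> carrier F" if "\<omega> \<in> space M" for \<omega>
      using measurable_space[OF \<gamma> that] by simp
    moreover have "s = \<zero>\<^bsub>F\<^esub>" using s C0 True by simp
    ultimately show ?thesis
      using uniform_rv_cong[OF uniform_rv_const[OF M zero_closed]] C0 True by simp
  next
    case False
    then have i1: "i \<in> {1..d}" using i by simp
    then obtain m where m: "s = pow m" "m mod d = i - 1"
      using s by (auto simp: C E_def)
    have sF: "s \<in> carrier F" "s \<noteq> \<zero>\<^bsub>F\<^esub>" using s C_sub[OF i1] by auto
    \<comment> \<open>Multiplying adds exponents. Reducing the sum modulo \<open>b * d\<close> keeps
      its residue modulo \<open>d\<close>, which is \<open>0 + (i - 1)\<close>.\<close>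
    have "pow j \<otimes>\<^bsub>F\<^esub> s \<in> C i" if "j \<in> E 1" for j
    proof -
      have "pow j \<otimes>\<^bsub>F\<^esub> s = pow ((j + m) mod (b * d))"
        using gF unfolding pow_mod m(1) by (simp add: pow_def nat_pow_mult)
      moreover have "((j + m) mod (b * d)) mod d = i - 1"
      proof -
        have "((j + m) mod (b * d)) mod d = (j + m) mod d"
          by (simp add: mod_mod_cancel)
        also have "\<dots> = (j mod d + m mod d) mod d" by (simp add: mod_add_eq)
        also have "\<dots> = (i - 1) mod d" using that m(2) by (simp add: E_def)
        also have "\<dots> = i - 1" using i1 by auto
        finally show ?thesis .
      qed
      ultimately show ?thesis
        using b assms(6) by (auto simp: C[OF i1] E_def)
    qed
    then have sub: "(\<lambda>x. x \<otimes>\<^bsub>F\<^esub> s) ` C 1 \<subseteq> C i"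
      unfolding C[OF one_d] by blast
    have inj: "inj_on (\<lambda>x. x \<otimes>\<^bsub>F\<^esub> s) (C 1)"
    proof (rule inj_onI)
      fix x y assume "x \<in> C 1" "y \<in> C 1" and eq: "x \<otimes>\<^bsub>F\<^esub> s = y \<otimes>\<^bsub>F\<^esub> s"
      then have "x \<in> carrier F" "y \<in> carrier F" using C_sub[OF one_d] by blast+
      then show "x = y" using eq m_rcancel[OF sF(2,1)] by simp
    qed
    \<comment> \<open>An injective image of a set with \<open>b\<close> elements inside a finite set
      with \<open>b\<close> elements is all of it.\<close>
    have img: "(\<lambda>x. x \<otimes>\<^bsub>F\<^esub> s) ` C 1 = C i"
      using sub inj card_C[OF i1] card_C[OF one_d] fin_C[OF i1]
      by (intro card_subset_eq) (auto simp: card_image)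
    have "C 1 \<subseteq> carrier F" using C_sub[OF one_d] by auto
    moreover have "(\<lambda>x. x \<otimes>\<^bsub>F\<^esub> s) \<in> carrier F \<rightarrow> carrier F" using sF by auto
    ultimately show ?thesis
      using uniform_rv_inj_image[OF assms(9)[unfolded R] fin_C[OF one_d] _ _ inj] img
      by simp
  qed
  show ?thesis
    using union part unif assms(9) C_sub[OF one_d]
    unfolding confusable_sets_def R by (auto simp: C_def)
qed

end
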